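(* Let $m,n\ge 1$ be integers and let $A=[A_{i,j}]_{i,j=1}^m\in \mathbb{M}_m(\mathbb{M}_n)$ be positive semidefinite. Then $$(\mathrm{tr}\, A)^{mn} - \bigl(\det(\mathrm{tr}_2 A)\bigr)^n \ \ge\ \Bigl|\, \det A - \bigl(\det(\mathrm{tr}_1 A)\bigr)^m \Bigr|.$$
   Context: $\mathbb{M}_n$ denotes the set of $n\times n$ complex matrices. $\mathbb{M}_m(\mathbb{M}_n)$ denotes the set of $mn\times mn$ complex matrices partitioned into $m\times m$ blocks, $A=[A_{i,j}]_{i,j=1}^m$, with each block $A_{i,j}\in\mathbb{M}_n$. $\mathrm{tr}\,A$ and $\det A$ are the usual trace and determinant of $A$ as an $mn\times mn$ matrix. The first and second partial traces of $A$ are $$\mathrm{tr}_1 A=\sum_{i=1}^m A_{i,i}\in\mathbb{M}_n,\qquad \mathrm{tr}_2 A=[\mathrm{tr}\,A_{i,j}]_{i,j=1}^m\in\mathbb{M}_m.$$ Positive semidefinite matrices are Hermitian by convention; if $A$ is positive semidefinite then so are $\mathrm{tr}_1 A$ and $\mathrm{tr}_2 A$, so all the traces and determinants in the claim are nonnegative real numbers. *)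

theory Defs
  imports
    "HOL-Library.Complex_Order"
    "Jordan_Normal_Form.Determinant"
    "Jordan_Normal_Form.Schur_Decomposition"
begin

definition trace :: "complex mat \<Rightarrow> complex" where
  "trace A = (\<Sum>i<dim_row A. A $$ (i, i))"

(* The last condition is v^* A v >= 0 in the order of HOL-Library.Complex_Order,
   where 0 <= z means that z is real and nonnegative. *)
definition positive_semidefinite :: "complex mat \<Rightarrow> bool" where
  "positive_semidefinite A \<longleftrightarrow>
     square_mat A \<and> mat_adjoint A = A \<and>
     (\<forall>v \<in> carrier_vec (dim_row A). 0 \<le> (A *\<^sub>v v) \<bullet>c v)"

(* The (i,j) block, of size n x n, of a matrix of size (m n) x (m n);
   block and entry indices start at 0. *)
definition block :: "nat \<Rightarrow> complex mat \<Rightarrow> nat \<Rightarrow> nat \<Rightarrow> complex mat" where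
  "block n A i j = mat n n (\<lambda>(k, l). A $$ (i * n + k, j * n + l))"

(* The sum of the diagonal blocks, written entrywise because the type of matrices
   of all dimensions is not an instance of comm_monoid_add. *)
definition partial_trace1 :: "nat \<Rightarrow> nat \<Rightarrow> complex mat \<Rightarrow> complex mat" where
  "partial_trace1 m n A = mat n n (\<lambda>(k, l). \<Sum>i<m. block n A i i $$ (k, l))"

definition partial_trace2 :: "nat \<Rightarrow> nat \<Rightarrow> complex mat \<Rightarrow> complex mat" where
  "partial_trace2 m n A = mat m m (\<lambda>(i, j). trace (block n A i j))"

end

theory Submission
  imports Defs
begin

text \<open>
  Write \<open>t\<close> for the trace of \<open>A\<close>; both partial traces are positive semidefinite with trace \<open>t\<close>
  as well. The claim compares \<open>t ^ (m * n)\<close> with the three numbers \<open>det A\<close>, \<open>det (tr\<^sub>1 A) ^ m\<close> and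
  \<open>det (tr\<^sub>2 A) ^ n\<close>, which are homogeneous of the same degree, and for \<open>m, n \<ge> 2\<close> a crude bound
  suffices. The determinant of a positive semidefinite matrix of size \<open>k \<ge> 2\<close> is a product of \<open>k\<close>
  nonnegative eigenvalues with sum \<open>t\<close>, hence at most \<open>t ^ k / 2\<close>
  (\<open>positive_semidefinite_twice_det_le\<close>). So each of the three numbers lies between \<open>0\<close> and half of
  \<open>t ^ (m * n)\<close>, whence \<open>\<bar>det A - det (tr\<^sub>1 A) ^ m\<bar> \<le> t ^ (m * n) / 2 \<le> t ^ (m * n) - det (tr\<^sub>2 A) ^ n\<close>.

  With a trivial tensor factor the claim is an equality. If \<open>n = 1\<close>, then \<open>tr\<^sub>2 A = A\<close> and \<open>tr\<^sub>1 A\<close>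
  is the scalar \<open>t\<close>, and the claim becomes \<open>t ^ m - det A \<ge> \<bar>det A - t ^ m\<bar>\<close>,
  which amounts to \<open>det A \<le> t ^ m\<close>; if \<open>m = 1\<close>, then
  \<open>tr\<^sub>1 A = A\<close> and \<open>tr\<^sub>2 A\<close> is the scalar \<open>t\<close>, and both sides vanish.
\<close>

section \<open>Positive semidefinite matrices and their quadratic forms\<close>

lemma mat_adjoint_index:
  assumes "i < dim_col A" "j < dim_row A"
  shows "mat_adjoint A $$ (i, j) = cnj (A $$ (j, i))"
  using assms by (simp add: mat_adjoint_def mat_of_rows_index)

lemma hermitian_iff:
  fixes A :: "complex mat"
  assumes "A \<in> carrier_mat n n"
  shows "mat_adjoint A = A \<longleftrightarrow> (\<forall>i<n. \<forall>j<n. cnj (A $$ (j, i)) = A $$ (i, j))"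
proof
  assume "mat_adjoint A = A"
  then show "\<forall>i<n. \<forall>j<n. cnj (A $$ (j, i)) = A $$ (i, j)"
    using mat_adjoint_index[of _ A] assms by (metis carrier_matD)
next
  assume "\<forall>i<n. \<forall>j<n. cnj (A $$ (j, i)) = A $$ (i, j)"
  then show "mat_adjoint A = A"
    using assms by (intro eq_matI) (auto simp: mat_adjoint_index, auto simp: mat_adjoint_def)
qed

lemma quadratic_form_eq_sum:
  fixes A :: "complex mat"
  assumes "A \<in> carrier_mat n n" "v \<in> carrier_vec n"
  shows "(A *\<^sub>v v) \<bullet>c v = (\<Sum>i<n. \<Sum>j<n. A $$ (i, j) * v $ j * cnj (v $ i))"
  using assms by (simp add: scalar_prod_def lessThan_atLeast0 sum_distrib_right)

text \<open>Test vectors as functions on indices make it possible to build them blockwise and to compute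
  with the quadratic form by reordering sums.\<close>

lemma positive_semidefinite_iff:
  assumes A: "A \<in> carrier_mat n n"
  shows "positive_semidefinite A \<longleftrightarrow>
     (\<forall>i<n. \<forall>j<n. cnj (A $$ (j, i)) = A $$ (i, j)) \<and>
     (\<forall>x. 0 \<le> (\<Sum>i<n. \<Sum>j<n. A $$ (i, j) * x j * cnj (x i)))"
proof -
  have "(\<forall>v \<in> carrier_vec n. 0 \<le> (A *\<^sub>v v) \<bullet>c v) \<longleftrightarrow>
        (\<forall>x. 0 \<le> (\<Sum>i<n. \<Sum>j<n. A $$ (i, j) * x j * cnj (x i)))" (is "?L \<longleftrightarrow> ?R")
  proof
    assume L: ?L
    show ?R
    proof
      fix x :: "nat \<Rightarrow> complex"
      show "0 \<le> (\<Sum>i<n. \<Sum>j<n. A $$ (i, j) * x j * cnj (x i))"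
        using L[rule_format, of "vec n x"] quadratic_form_eq_sum[OF A, of "vec n x"] by simp
    qed
  next
    assume ?R
    then show ?L
      by (simp add: quadratic_form_eq_sum[OF A])
  qed
  then show ?thesis
    using A unfolding positive_semidefinite_def hermitian_iff[OF A] by auto
qed

section \<open>The eigenvalues of a positive semidefinite matrix\<close>

lemma trace_mult_commute:
  assumes "A \<in> carrier_mat n m" "B \<in> carrier_mat m n"
  shows "trace (A * B) = trace (B * A)"
proof -
  have "trace (A * B) = (\<Sum>i<n. \<Sum>j<m. A $$ (i, j) * B $$ (j, i))"
    using assms by (simp add: trace_def scalar_prod_def lessThan_atLeast0)
  also have "\<dots> = (\<Sum>j<m. \<Sum>i<n. B $$ (j, i) * A $$ (i, j))"
    by (subst sum.swap) (simp add: mult.commute)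
  also have "\<dots> = trace (B * A)"
    using assms by (simp add: trace_def scalar_prod_def lessThan_atLeast0)
  finally show ?thesis .
qed

lemma trace_similar:
  assumes "similar_mat A B"
  shows "trace A = trace B"
proof -
  obtain n P Q where carr: "{A, B, P, Q} \<subseteq> carrier_mat n n"
    and QP: "Q * P = 1\<^sub>m n" and A: "A = P * B * Q"
    using similar_matD[OF assms] by blast
  have "trace A = trace (Q * (P * B))"
    unfolding A using carr by (intro trace_mult_commute[of _ n n]) auto
  also have "Q * (P * B) = (Q * P) * B"
    using carr by (simp add: assoc_mult_mat[of Q n n P n B n])
  also have "\<dots> = B"
    using carr QP by (simp add: left_mult_one_mat[of B n n])
  finally show ?thesis .
qed

text \<open>If \<open>A v = e v\<close> with \<open>v \<noteq> 0\<close>, then the quadratic form at \<open>v\<close> is \<open>e\<close> times the squared norm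
  of \<open>v\<close>.\<close>

lemma positive_semidefinite_eigenvalue_nonneg:
  assumes "positive_semidefinite A" "eigenvalue A e"
  shows "0 \<le> e"
proof -
  obtain v where v: "v \<in> carrier_vec (dim_row A)" "v \<noteq> 0\<^sub>v (dim_row A)" "A *\<^sub>v v = e \<cdot>\<^sub>v v"
    using assms(2) unfolding eigenvalue_def eigenvector_def by blast
  have "0 \<le> (A *\<^sub>v v) \<bullet>c v"
    using assms(1) v(1) unfolding positive_semidefinite_def by blast
  also have "\<dots> = e * (v \<bullet>c v)"
    using v by simp
  finally have nonneg: "0 \<le> e * (v \<bullet>c v)" .
  have "0 < v \<bullet>c v"
    using v conjugate_square_greater_0_vec by blast
  then have pos: "0 < Re (v \<bullet>c v)" "Im (v \<bullet>c v) = 0"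
    by (simp_all add: less_complex_def)
  show ?thesis
    using nonneg pos by (auto simp: less_eq_complex_def zero_le_mult_iff)
qed

text \<open>By Schur's triangularisation the determinant and the trace are the product and the sum of the
  roots of the characteristic polynomial, with multiplicities.\<close>

lemma positive_semidefinite_eigenvalues:
  assumes A: "A \<in> carrier_mat n n" and psd: "positive_semidefinite A"
  obtains es :: "real list" where "length es = n" "\<forall>e \<in> set es. 0 \<le> e"
    "det A = of_real (prod_list es)" "trace A = of_real (sum_list es)"
proof -
  obtain as where as: "char_poly A = (\<Prod>a\<leftarrow>as. [:- a, 1:])" "length as = n"
    using char_poly_factorized[OF A] by blast
  obtain B P Q where "schur_decomposition A as = (B, P, Q)"
    by (cases "schur_decomposition A as") auto
  from schur_decomposition[OF A as(1) this]
  have wit: "similar_mat_wit A B P Q" and ut: "upper_triangular B" and diag: "diag_mat B = as"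
    by auto
  have sim: "similar_mat A B"
    using wit unfolding similar_mat_def by blast
  have B: "B \<in> carrier_mat n n"
    using similar_mat_witD2[OF A wit] by blast
  have nonneg: "0 \<le> a" if "a \<in> set as" for a
  proof (rule positive_semidefinite_eigenvalue_nonneg[OF psd])
    show "eigenvalue A a"
      unfolding eigenvalue_root_char_poly[OF A] as(1) using linear_poly_root[OF that] by simp
  qed
  have real: "of_real (Re a) = a" if "a \<in> set as" for a
    using nonneg[OF that] by (simp add: less_eq_complex_def complex_eq_iff)
  have map: "map (complex_of_real \<circ> Re) as = as"
    using real by (simp add: map_idI)
  have prod: "complex_of_real (prod_list xs) = prod_list (map of_real xs)" for xs
    by (induction xs) auto
  have sum: "complex_of_real (sum_list xs) = sum_list (map of_real xs)" for xs
    by (induction xs) auto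
  show thesis
  proof
    show "length (map Re as) = n"
      using as by simp
    show "\<forall>e \<in> set (map Re as). 0 \<le> e"
      using nonneg by (auto simp: less_eq_complex_def)
    show "det A = of_real (prod_list (map Re as))"
      using det_similar[OF sim] det_upper_triangular[OF ut B] map by (simp add: prod diag)
    have "trace B = sum_list (diag_mat B)"
      using B by (simp add: trace_def diag_mat_def sum_list_sum_nth lessThan_atLeast0)
    then show "trace A = of_real (sum_list (map Re as))"
      using trace_similar[OF sim] map by (simp add: sum diag)
  qed
qed

section \<open>Determinant against trace\<close>

lemma prod_list_le_sum_list_power:
  fixes xs :: "real list"
  assumes "\<forall>x \<in> set xs. 0 \<le> x"
  shows "prod_list xs \<le> sum_list xs ^ length xs"
  using assms
proof (induction xs)
  case (Cons x xs)
  have x: "0 \<le> x" and s: "0 \<le> sum_list xs"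
    using Cons.prems by (auto intro: sum_list_nonneg)
  have "x * prod_list xs \<le> x * sum_list xs ^ length xs"
    using Cons x by (intro mult_left_mono) auto
  also have "\<dots> \<le> (x + sum_list xs) * (x + sum_list xs) ^ length xs"
    using x s by (intro mult_mono power_mono) auto
  finally show ?case
    by simp
qed auto

text \<open>Two of the factors suffice to gain the factor 2, because \<open>2 * x * y \<le> (x + y)\<^sup>2\<close>.\<close>

lemma twice_prod_list_le_sum_list_power:
  fixes xs :: "real list"
  assumes "\<forall>x \<in> set xs. 0 \<le> x" "2 \<le> length xs"
  shows "2 * prod_list xs \<le> sum_list xs ^ length xs"
proof -
  obtain x y ys where xs: "xs = x # y # ys"
    using assms(2) by (metis One_nat_def Suc_1 Suc_le_length_iff)
  have x: "0 \<le> x" and y: "0 \<le> y" and s: "0 \<le> sum_list ys" and ys: "\<forall>z \<in> set ys. 0 \<le> z"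
    using assms(1) xs by (auto intro: sum_list_nonneg)
  let ?s = "x + y + sum_list ys"
  have "2 * x * y \<le> (x + y)\<^sup>2"
    by (simp add: power2_sum)
  also have "\<dots> \<le> ?s\<^sup>2"
    using x y s by (intro power_mono) auto
  finally have "2 * x * y \<le> ?s\<^sup>2" .
  moreover have "prod_list ys \<le> ?s ^ length ys"
    using prod_list_le_sum_list_power[OF ys] power_mono[of "sum_list ys" ?s "length ys"] x y s
    by linarith
  moreover have "0 \<le> prod_list ys"
    using ys by (induction ys) auto
  ultimately have "(2 * x * y) * prod_list ys \<le> ?s\<^sup>2 * ?s ^ length ys"
    by (intro mult_mono) auto
  then show ?thesis
    by (simp add: xs power2_eq_square algebra_simps)
qed

lemma prod_list_nonneg_real:
  fixes xs :: "real list"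
  assumes "\<forall>x \<in> set xs. 0 \<le> x"
  shows "0 \<le> prod_list xs"
  using assms by (induction xs) auto

text \<open>The real parts are taken only to state the comparison in the reals: trace and determinant of a
  positive semidefinite matrix are real.\<close>

lemma positive_semidefinite_trace_real:
  assumes "A \<in> carrier_mat n n" "positive_semidefinite A"
  shows "trace A = of_real (Re (trace A))"
  by (rule positive_semidefinite_eigenvalues[OF assms]) simp

lemma positive_semidefinite_det_nonneg:
  assumes "A \<in> carrier_mat n n" "positive_semidefinite A"
  shows "det A = of_real (Re (det A))" "0 \<le> Re (det A)"
  by (rule positive_semidefinite_eigenvalues[OF assms], simp add: prod_list_nonneg_real)+

lemma positive_semidefinite_det_le:
  assumes "A \<in> carrier_mat n n" "positive_semidefinite A"
  shows "Re (det A) \<le> Re (trace A) ^ n"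
  by (rule positive_semidefinite_eigenvalues[OF assms]) (use prod_list_le_sum_list_power in force)

lemma positive_semidefinite_twice_det_le:
  assumes "A \<in> carrier_mat n n" "positive_semidefinite A" "2 \<le> n"
  shows "2 * Re (det A) \<le> Re (trace A) ^ n"
  by (rule positive_semidefinite_eigenvalues[OF assms(1,2)])
    (use assms(3) twice_prod_list_le_sum_list_power in force)

section \<open>Partial traces\<close>

lemma sum_lessThan_mult:
  "(\<Sum>p<m * n. f p) = (\<Sum>i<m. \<Sum>k<n. f (i * n + k :: nat))"
proof -
  have "(\<Sum>p<m * n. f p) = (\<Sum>i<m. sum f {i * n..<i * n + n})"
    by (rule sum.nat_group[symmetric])
  also have "\<dots> = (\<Sum>i<m. \<Sum>k<n. f (i * n + k))"
  proof (rule sum.cong[OF refl])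
    fix i
    show "sum f {i * n..<i * n + n} = (\<Sum>k<n. f (i * n + k))"
      using sum.shift_bounds_nat_ivl[of f 0 "i * n" n]
      by (simp add: lessThan_atLeast0 add.commute)
  qed
  finally show ?thesis .
qed

lemma block_index_less:
  assumes "i < m" "k < (n :: nat)"
  shows "i * n + k < m * n"
proof -
  have "i * n + k < Suc i * n"
    using assms by simp
  also have "\<dots> \<le> m * n"
    using assms by (intro mult_right_mono) auto
  finally show ?thesis .
qed

lemma partial_trace1_carrier: "partial_trace1 m n A \<in> carrier_mat n n"
  by (simp add: partial_trace1_def)

lemma partial_trace1_index:
  assumes "k < n" "l < n"
  shows "partial_trace1 m n A $$ (k, l) = (\<Sum>i<m. A $$ (i * n + k, i * n + l))"
  using assms by (simp add: partial_trace1_def block_def)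

lemma partial_trace2_carrier: "partial_trace2 m n A \<in> carrier_mat m m"
  by (simp add: partial_trace2_def)

lemma partial_trace2_index:
  assumes "i < m" "j < m"
  shows "partial_trace2 m n A $$ (i, j) = (\<Sum>k<n. A $$ (i * n + k, j * n + k))"
  using assms by (simp add: partial_trace2_def block_def trace_def)

lemma trace_partial_trace1:
  assumes "A \<in> carrier_mat (m * n) (m * n)"
  shows "trace (partial_trace1 m n A) = trace A"
proof -
  have "trace (partial_trace1 m n A) = (\<Sum>k<n. \<Sum>i<m. A $$ (i * n + k, i * n + k))"
    using partial_trace1_carrier[of m n A] by (simp add: trace_def partial_trace1_index)
  also have "\<dots> = (\<Sum>i<m. \<Sum>k<n. A $$ (i * n + k, i * n + k))"
    by (rule sum.swap)
  also have "\<dots> = trace A"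
    using assms by (simp add: trace_def sum_lessThan_mult)
  finally show ?thesis .
qed

lemma trace_partial_trace2:
  assumes "A \<in> carrier_mat (m * n) (m * n)"
  shows "trace (partial_trace2 m n A) = trace A"
  using assms partial_trace2_carrier[of m n A]
  by (simp add: trace_def partial_trace2_index sum_lessThan_mult)

text \<open>Splitting each index \<open>p < m * n\<close> as \<open>a * n + k\<close> identifies \<open>\<complex>\<^sup>m\<^sup>n\<close> with \<open>\<complex>\<^sup>m \<otimes> \<complex>\<^sup>n\<close>; the
  test vector \<open>y\<close> is arbitrary because both partial traces are treated by choosing it as a
  product vector.\<close>

lemma positive_semidefinite_tensor_form_nonneg:
  assumes "A \<in> carrier_mat (m * n) (m * n)" "positive_semidefinite A"
  shows "0 \<le> (\<Sum>a<m. \<Sum>k<n. \<Sum>b<m. \<Sum>l<n. A $$ (a * n + k, b * n + l) * y b l * cnj (y a k))"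
proof -
  define x where "x p = y (p div n) (p mod n)" for p
  have x: "x (a * n + k) = y a k" if "k < n" for a k
    using that by (simp add: x_def)
  have "0 \<le> (\<Sum>p<m * n. \<Sum>q<m * n. A $$ (p, q) * x q * cnj (x p))"
    using assms positive_semidefinite_iff by blast
  then show ?thesis
    by (simp add: sum_lessThan_mult x)
qed

text \<open>The form of \<open>tr\<^sub>1 A\<close> at \<open>x\<close> is the sum over \<open>i\<close> of the form of \<open>A\<close> at \<open>e\<^sub>i \<otimes> x\<close>.\<close>

lemma positive_semidefinite_partial_trace1:
  assumes A: "A \<in> carrier_mat (m * n) (m * n)" and psd: "positive_semidefinite A"
  shows "positive_semidefinite (partial_trace1 m n A)"
  unfolding positive_semidefinite_iff[OF partial_trace1_carrier]
proof (intro conjI allI impI)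
  fix k l assume "k < n" "l < n"
  then show "cnj (partial_trace1 m n A $$ (l, k)) = partial_trace1 m n A $$ (k, l)"
    using psd block_index_less unfolding positive_semidefinite_iff[OF A]
    by (simp add: partial_trace1_index)
next
  fix x :: "nat \<Rightarrow> complex"
  have "0 \<le> (\<Sum>k<n. \<Sum>l<n. A $$ (i * n + k, i * n + l) * x l * cnj (x k))" if "i < m" for i
  proof -
    let ?y = "\<lambda>a k. if a = i then x k else 0"
    have l_sum: "(\<Sum>l<n. A $$ (a * n + k, b * n + l) * ?y b l * cnj (?y a k))
        = (if b = i then if a = i then \<Sum>l<n. A $$ (i * n + k, i * n + l) * x l * cnj (x k) else 0
           else 0)" for a b k
      by simp
    have "(\<Sum>k<n. \<Sum>b<m. \<Sum>l<n. A $$ (a * n + k, b * n + l) * ?y b l * cnj (?y a k))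
        = (if a = i then \<Sum>k<n. \<Sum>l<n. A $$ (i * n + k, i * n + l) * x l * cnj (x k) else 0)" for a
      unfolding l_sum using that by (cases "a = i") simp_all
    then have "(\<Sum>a<m. \<Sum>k<n. \<Sum>b<m. \<Sum>l<n. A $$ (a * n + k, b * n + l) * ?y b l * cnj (?y a k))
        = (\<Sum>k<n. \<Sum>l<n. A $$ (i * n + k, i * n + l) * x l * cnj (x k))"
      using that by simp
    then show ?thesis
      using positive_semidefinite_tensor_form_nonneg[OF A psd, of ?y] by simp
  qed
  then have "0 \<le> (\<Sum>i<m. \<Sum>k<n. \<Sum>l<n. A $$ (i * n + k, i * n + l) * x l * cnj (x k))"
    by (rule sum_nonneg) simp
  also have "\<dots> = (\<Sum>k<n. \<Sum>i<m. \<Sum>l<n. A $$ (i * n + k, i * n + l) * x l * cnj (x k))"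
    by (rule sum.swap)
  also have "\<dots> = (\<Sum>k<n. \<Sum>l<n. \<Sum>i<m. A $$ (i * n + k, i * n + l) * x l * cnj (x k))"
    by (intro sum.cong refl sum.swap)
  also have "\<dots> = (\<Sum>k<n. \<Sum>l<n. partial_trace1 m n A $$ (k, l) * x l * cnj (x k))"
    by (simp add: partial_trace1_index sum_distrib_right)
  finally show "0 \<le> (\<Sum>k<n. \<Sum>l<n. partial_trace1 m n A $$ (k, l) * x l * cnj (x k))" .
qed

text \<open>The form of \<open>tr\<^sub>2 A\<close> at \<open>x\<close> is the sum over \<open>k\<close> of the form of \<open>A\<close> at \<open>x \<otimes> e\<^sub>k\<close>.\<close>

lemma positive_semidefinite_partial_trace2:
  assumes A: "A \<in> carrier_mat (m * n) (m * n)" and psd: "positive_semidefinite A"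
  shows "positive_semidefinite (partial_trace2 m n A)"
  unfolding positive_semidefinite_iff[OF partial_trace2_carrier]
proof (intro conjI allI impI)
  fix i j assume "i < m" "j < m"
  then show "cnj (partial_trace2 m n A $$ (j, i)) = partial_trace2 m n A $$ (i, j)"
    using psd block_index_less unfolding positive_semidefinite_iff[OF A]
    by (simp add: partial_trace2_index)
next
  fix x :: "nat \<Rightarrow> complex"
  have "0 \<le> (\<Sum>a<m. \<Sum>b<m. A $$ (a * n + k, b * n + k) * x b * cnj (x a))" if "k < n" for k
  proof -
    let ?y = "\<lambda>a l. if l = k then x a else 0"
    have l_sum: "(\<Sum>l<n. A $$ (a * n + c, b * n + l) * ?y b l * cnj (?y a c))
        = (if c = k then A $$ (a * n + k, b * n + k) * x b * cnj (x a) else 0)" for a b c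
    proof -
      have "(\<Sum>l<n. A $$ (a * n + c, b * n + l) * ?y b l * cnj (?y a c))
          = (\<Sum>l<n. if l = k then A $$ (a * n + c, b * n + l) * x b * cnj (?y a c) else 0)"
        by (intro sum.cong) auto
      then show ?thesis
        using that by simp
    qed
    have "(\<Sum>c<n. \<Sum>b<m. \<Sum>l<n. A $$ (a * n + c, b * n + l) * ?y b l * cnj (?y a c))
        = (\<Sum>c<n. if c = k then \<Sum>b<m. A $$ (a * n + k, b * n + k) * x b * cnj (x a) else 0)" for a
      unfolding l_sum by (intro sum.cong) auto
    then have "(\<Sum>a<m. \<Sum>c<n. \<Sum>b<m. \<Sum>l<n. A $$ (a * n + c, b * n + l) * ?y b l * cnj (?y a c))
        = (\<Sum>a<m. \<Sum>b<m. A $$ (a * n + k, b * n + k) * x b * cnj (x a))"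
      using that by simp
    then show ?thesis
      using positive_semidefinite_tensor_form_nonneg[OF A psd, of ?y] by simp
  qed
  then have "0 \<le> (\<Sum>k<n. \<Sum>a<m. \<Sum>b<m. A $$ (a * n + k, b * n + k) * x b * cnj (x a))"
    by (rule sum_nonneg) simp
  also have "\<dots> = (\<Sum>a<m. \<Sum>k<n. \<Sum>b<m. A $$ (a * n + k, b * n + k) * x b * cnj (x a))"
    by (rule sum.swap)
  also have "\<dots> = (\<Sum>a<m. \<Sum>b<m. \<Sum>k<n. A $$ (a * n + k, b * n + k) * x b * cnj (x a))"
    by (intro sum.cong refl sum.swap)
  also have "\<dots> = (\<Sum>a<m. \<Sum>b<m. partial_trace2 m n A $$ (a, b) * x b * cnj (x a))"
    by (simp add: partial_trace2_index sum_distrib_right)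
  finally show "0 \<le> (\<Sum>a<m. \<Sum>b<m. partial_trace2 m n A $$ (a, b) * x b * cnj (x a))" .
qed

lemma partial_trace1_one_block:
  assumes "A \<in> carrier_mat n n"
  shows "partial_trace1 1 n A = A"
  using assms by (intro eq_matI) (auto simp: partial_trace1_index, auto simp: partial_trace1_def)

lemma partial_trace2_scalar_blocks:
  assumes "A \<in> carrier_mat m m"
  shows "partial_trace2 m 1 A = A"
  using assms by (intro eq_matI) (auto simp: partial_trace2_index, auto simp: partial_trace2_def)

lemma det_one_by_one:
  assumes "A \<in> carrier_mat 1 1"
  shows "det A = trace A"
  using assms det_single[of A] by (simp add: trace_def)

section \<open>The inequality\<close>

text \<open>The factor 2 survives taking the power \<open>k \<ge> 1\<close>, since \<open>2 \<le> 2 ^ k\<close>.\<close>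

lemma twice_power_le:
  fixes d s :: real
  assumes "0 \<le> d" "2 * d \<le> s" "1 \<le> k"
  shows "2 * d ^ k \<le> s ^ k"
proof -
  have "2 ^ 1 \<le> (2 :: real) ^ k"
    using assms(3) by (intro power_increasing) auto
  then have "2 * d ^ k \<le> 2 ^ k * d ^ k"
    using assms(1) by (intro mult_right_mono) auto
  also have "\<dots> = (2 * d) ^ k"
    by (simp add: power_mult_distrib)
  also have "\<dots> \<le> s ^ k"
    using assms by (intro power_mono) auto
  finally show ?thesis .
qed

theorem theorem1p1:
  fixes m n :: nat and A :: "complex mat"
  assumes "m \<ge> 1" and "n \<ge> 1"
    and "A \<in> carrier_mat (m * n) (m * n)"
    and "positive_semidefinite A"
  shows "trace A ^ (m * n) - det (partial_trace2 m n A) ^ n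
           \<ge> complex_of_real (cmod (det A - det (partial_trace1 m n A) ^ m))"
proof -
  note A = assms(3) and psd = assms(4)
  note car1 = partial_trace1_carrier[of m n A]
    and psd1 = positive_semidefinite_partial_trace1[OF A psd]
    and tr1 = trace_partial_trace1[OF A]
  note car2 = partial_trace2_carrier[of m n A]
    and psd2 = positive_semidefinite_partial_trace2[OF A psd]
    and tr2 = trace_partial_trace2[OF A]
  define t where "t = Re (trace A)"
  define d where "d = Re (det A)"
  define d1 where "d1 = Re (det (partial_trace1 m n A))"
  define d2 where "d2 = Re (det (partial_trace2 m n A))"
  have t: "trace A = of_real t"
    unfolding t_def by (rule positive_semidefinite_trace_real[OF A psd])
  have d: "det A = of_real d" "0 \<le> d"
    unfolding d_def by (rule positive_semidefinite_det_nonneg[OF A psd])+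
  have d1: "det (partial_trace1 m n A) = of_real d1" "0 \<le> d1"
    unfolding d1_def by (rule positive_semidefinite_det_nonneg[OF car1 psd1])+
  have d2: "det (partial_trace2 m n A) = of_real d2" "0 \<le> d2"
    unfolding d2_def by (rule positive_semidefinite_det_nonneg[OF car2 psd2])+
  have ineq: "\<bar>d - d1 ^ m\<bar> \<le> t ^ (m * n) - d2 ^ n"
  proof -
    consider "m = 1" | "n = 1" | "2 \<le> m" "2 \<le> n"
      using assms(1,2) by linarith
    then show ?thesis
    proof cases
      case 1
      have "d1 = d"
        using A 1 partial_trace1_one_block[of A n] by (simp add: d1_def d_def)
      moreover have "d2 = t"
        using 1 car2 tr2 det_one_by_one[of "partial_trace2 m n A"] by (simp add: d2_def t_def)
      ultimately show ?thesis
        using 1 by simp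
    next
      case 2
      have "d2 = d"
        using A 2 partial_trace2_scalar_blocks[of A m] by (simp add: d2_def d_def)
      moreover have "d1 = t"
        using 2 car1 tr1 det_one_by_one[of "partial_trace1 m n A"] by (simp add: d1_def t_def)
      moreover have "d \<le> t ^ m"
        using 2 positive_semidefinite_det_le[OF A psd] by (simp add: d_def t_def)
      ultimately show ?thesis
        using 2 by simp
    next
      case 3
      have "2 * 1 \<le> m * n"
        using 3 by (intro mult_le_mono) auto
      then have "2 * d \<le> t ^ (m * n)"
        using positive_semidefinite_twice_det_le[OF A psd] by (simp add: d_def t_def)
      moreover have "2 * d1 ^ m \<le> t ^ (m * n)"
        using twice_power_le[OF d1(2), of "t ^ n" m]
          positive_semidefinite_twice_det_le[OF car1 psd1 3(2)] assms(1)
        by (simp add: d1_def t_def tr1 power_mult[symmetric] mult.commute)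
      moreover have "2 * d2 ^ n \<le> t ^ (m * n)"
        using twice_power_le[OF d2(2), of "t ^ m" n]
          positive_semidefinite_twice_det_le[OF car2 psd2 3(1)] assms(2)
        by (simp add: d2_def t_def tr2 power_mult[symmetric])
      ultimately show ?thesis
        using d(2) zero_le_power[OF d1(2), of m] by linarith
    qed
  qed
  have "complex_of_real (cmod (det A - det (partial_trace1 m n A) ^ m))
      = of_real \<bar>d - d1 ^ m\<bar>"
    unfolding d d1 by (metis norm_of_real of_real_diff of_real_power)
  moreover have "trace A ^ (m * n) - det (partial_trace2 m n A) ^ n
      = of_real (t ^ (m * n) - d2 ^ n)"
    unfolding t d2 by simp
  ultimately show ?thesis
    using ineq by (simp only: less_eq_complex_def) simp
qed

end
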